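(* Let $F_n$ denote the Fibonacci numbers. The following hold. For every non-negative integer $m$ and every positive integer $n$, $$\sum_{k=0}^{\lfloor m/2\rfloor}\frac12\left((-1)^{\left\lfloor\frac{m-2k}{3}\right\rfloor}-(-1)^{\left\lfloor\frac{m-2k-2}{3}\right\rfloor}\right)c_{m,k}=\sum_{k=0}^{\left\lfloor\frac{n-1}{3}\right\rfloor}(-1)^k c_{n-1,\left\lfloor\frac{n-1-3k}{2}\right\rfloor}=1.$$ For every non-negative integer $m$, with $n=m+1$, $$\sum_{k=0}^{\lfloor m/2\rfloor}\frac12\left((-1)^{\left\lfloor\frac{m-2k}{5}\right\rfloor}-(-1)^{\left\lfloor\frac{m-2k-2}{5}\right\rfloor}\right)c_{m+1,k}=\sum_{k=0}^{\left\lfloor\frac{n-1}{5}\right\rfloor}(-1)^k c_{n,\left\lfloor\frac{n-1-5k}{2}\right\rfloor}=F_{m+1}.$$ For every non-negative integer $n$, $$\sum_{k=0}^{\lfloor n/2\rfloor}(-1)^k\binom{n-k}{k}=\begin{cases}1&(n\equiv0,1\ (\mathrm{mod}\ 6))\\-1&(n\equiv3,4\ (\mathrm{mod}\ 6))\\0&(\text{otherwise}),\end{cases}$$ $$\sum_{k=0}^{\lfloor n/2\rfloor}(-1)^k\binom{n-k+1}{k}F_{n-2k+1}=\begin{cases}1&(n\equiv0,1\ (\mathrm{mod}\ 10))\\-1&(n\equiv5,6\ (\mathrm{mod}\ 10))\\0&(\text{otherwise}).\end{cases}$$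
   Context: $F_n=\frac1{\sqrt5}\left(\left(\frac{1+\sqrt5}2\right)^n-\left(\frac{1-\sqrt5}2\right)^n\right)$ are the Fibonacci numbers. For an integer $n$, $\binom nk=\frac{n(n-1)\cdots(n-k+1)}{k!}$ for $k\ge1$, $\binom n0=1$, $\binom nk=0$ for $k<0$; $c_{n,k}:=\binom nk-\binom n{k-1}$. $\lfloor x\rfloor$ is the greatest integer not exceeding $x$. *)

theory Defs
  imports Complex_Main "HOL-Number_Theory.Fib"
begin

definition ibinom :: "int \<Rightarrow> int \<Rightarrow> real" where
  "ibinom n k = (if k < 0 then 0 else real_of_int n gchoose nat k)"

lemma ibinom_nonneg:
  "ibinom n (int k) = (\<Prod>i<k. real_of_int n - real i) / fact k"
  by (simp add: ibinom_def gbinomial_prod_rev lessThan_atLeast0)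

definition cdiff :: "int \<Rightarrow> int \<Rightarrow> real" where
  "cdiff n k = ibinom n k - ibinom n (k - 1)"

lemma fib_binet:
  "real (fib n) = 1 / sqrt 5 * (((1 + sqrt 5) / 2) ^ n - ((1 - sqrt 5) / 2) ^ n)"
  using fib_closed_form[of n] by simp

end

theory Submission
  imports Defs
begin

text \<open>
  All four identities are evaluations of one pair of mutually inverse expansions.  Let
  \<open>U\<^sub>n = U\<^sub>n(x, 1)\<close> be the Lucas sequence with \<open>U\<^sub>0 = 0\<close>, \<open>U\<^sub>1 = 1\<close> and
  \<open>U\<^sub>n\<^sub>+\<^sub>2 = x U\<^sub>n\<^sub>+\<^sub>1 - U\<^sub>n\<close>; thus \<open>U\<^sub>n\<^sub>+\<^sub>1\<close> is the Chebyshev polynomial of the second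
  kind of degree \<open>n\<close> evaluated at \<open>x / 2\<close>.  Powers of \<open>x\<close> expand in the \<open>U\<^sub>n\<close> with the ballot
  numbers \<open>c\<^sub>m\<^sub>,\<^sub>k\<close> as coefficients, and the \<open>U\<^sub>n\<close> expand in powers of \<open>x\<close> with alternating
  diagonal binomial coefficients:

    \<open>x\<^sup>m = (\<Sum>2 k \<le> m. c\<^sub>m\<^sub>,\<^sub>k * U\<^sub>m\<^sub>+\<^sub>1\<^sub>-\<^sub>2\<^sub>k)\<close>  and
    \<open>U\<^sub>n\<^sub>+\<^sub>1 = (\<Sum>2 k \<le> n. (-1)\<^sup>k * (n - k choose k) * x\<^sup>n\<^sup>-\<^sup>2\<^sup>k)\<close>.

  These are \<open>power_eq_sum_cdiff_lucas_U\<close> and \<open>lucas_U_eq_sum_binomial\<close>.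

  At \<open>x = 1\<close> the sequence \<open>U\<^sub>n\<^sub>+\<^sub>1\<close> changes sign under \<open>n \<mapsto> n + 3\<close> and reads
  1, 1, 0, -1, -1, 0.  At a root of \<open>x\<^sup>2 = x + 1\<close> it changes sign under \<open>n \<mapsto> n + 5\<close>, and
  the coefficient of \<open>x\<close> in \<open>U\<^sub>n\<^sub>+\<^sub>2\<close> reads 1, 1, 0, 0, 0, -1, -1, 0, 0, 0; subtracting the
  values at the two roots and dividing by the difference of the roots isolates this coefficient.
  The same operation turns \<open>x\<^sup>n\<close> into the
  Fibonacci number \<open>F\<^sub>n\<close>.  So the first expansion gives the values of the ballot-number sums, and
  the second gives the two periodic sums.

  The halved differences of signs in the statement are these two periodic sequences.
  Listing only their nonzero terms yields the sums with indices
  \<open>\<lfloor>(m - p k) / 2\<rfloor>\<close> (\<open>sum_sign_wave_reindex\<close>).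
\<close>

section \<open>Ballot numbers\<close>

lemma ibinom_of_nat: "ibinom (int n) (int k) = real (n choose k)"
  by (simp add: ibinom_def binomial_gbinomial)

lemma ibinom_plus_1: "ibinom (n + 1) k = ibinom n k + ibinom n (k - 1)"
proof (cases "k \<le> 0")
  case True
  then show ?thesis by (auto simp: ibinom_def)
next
  case False
  then obtain j where "k = int (Suc j)"
    by (metis gr0_implies_Suc not_le zero_less_imp_eq_int)
  then show ?thesis
    by (simp add: ibinom_def gbinomial_Suc_Suc nat_add_distrib)
qed

lemma cdiff_plus_1: "cdiff (n + 1) k = cdiff n k + cdiff n (k - 1)"
  by (simp add: cdiff_def ibinom_plus_1)

lemma cdiff_middle_eq_0:
  assumes "2 * k = m + 1"
  shows "cdiff (int m) (int k) = 0"
proof -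
  obtain j where j: "k = Suc j" "m = 2 * j + 1"
    using assms by (cases k) auto
  have "(m choose k) = (m choose j)"
    using j binomial_symmetric[of k m] by simp
  moreover have "int k - 1 = int j"
    using j by simp
  ultimately show ?thesis
    by (simp add: cdiff_def ibinom_of_nat)
qed

section \<open>Expansions between powers and the Lucas sequence\<close>

fun lucas_U :: "real \<Rightarrow> nat \<Rightarrow> real" where
  "lucas_U x 0 = 0"
| "lucas_U x (Suc 0) = 1"
| "lucas_U x (Suc (Suc n)) = x * lucas_U x (Suc n) - lucas_U x n"

text \<open>
  Multiplication by \<open>x\<close> replaces \<open>U\<^sub>j\<close> by \<open>U\<^sub>j\<^sub>+\<^sub>1 + U\<^sub>j\<^sub>-\<^sub>1\<close>; collecting terms, the coefficients
  obey the Pascal recurrence, as ballot numbers do.  Since \<open>U\<^sub>0 = 0\<close>, truncated subtraction makes all terms with \<open>2 k > m\<close> vanish,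
  so the upper limit may be any sufficiently large \<open>K\<close>; this freedom lets the induction
  disregard the parity of \<open>m\<close>.
\<close>
lemma power_eq_sum_cdiff_lucas_U:
  assumes "m < 2 * K + 2"
  shows "(\<Sum>k\<le>K. cdiff (int m) (int k) * lucas_U x (m + 1 - 2 * k)) = x ^ m"
  using assms
proof (induction m)
  case 0
  have "(\<Sum>k\<le>K. cdiff (int 0) (int k) * lucas_U x (0 + 1 - 2 * k))
      = (\<Sum>k\<le>K. if k = 0 then 1 else 0)"
    by (rule sum.cong) (auto simp: cdiff_def ibinom_def)
  then show ?case by simp
next
  case (Suc m)
  let ?c = "\<lambda>k. cdiff (int m) (int k)"
  have step: "?c k * (x * lucas_U x (m + 1 - 2 * k))
      = ?c k * lucas_U x (m + 2 - 2 * k) + ?c k * lucas_U x (m - 2 * k)" for k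
  proof -
    consider "2 * k \<le> m" | "2 * k = m + 1" | "2 * k > m + 1" by linarith
    then show ?thesis
    proof cases
      case 1
      then have "m + 2 - 2 * k = Suc (Suc (m - 2 * k))" "m + 1 - 2 * k = Suc (m - 2 * k)"
        by simp_all
      then show ?thesis by (simp only: lucas_U.simps) (simp add: algebra_simps)
    next
      (* The recurrence fails here, as it would require U_{-1} = -1 instead of 0. *)
      case 2
      then show ?thesis by (simp add: cdiff_middle_eq_0)
    next
      case 3
      then show ?thesis by simp
    qed
  qed
  have shifted: "(\<Sum>k\<le>K. cdiff (int m) (int k - 1) * lucas_U x (m + 2 - 2 * k))
      = (\<Sum>k\<le>K. ?c k * lucas_U x (m - 2 * k))"
  proof -
    have "(\<Sum>k\<le>K. cdiff (int m) (int k - 1) * lucas_U x (m + 2 - 2 * k))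
        = (\<Sum>k<Suc K. cdiff (int m) (int k - 1) * lucas_U x (m + 2 - 2 * k))"
      by (simp only: lessThan_Suc_atMost)
    also have "\<dots> = (\<Sum>k<K. ?c k * lucas_U x (m - 2 * k))"
      by (subst sum.lessThan_Suc_shift) (simp add: cdiff_def ibinom_def)
    also have "\<dots> = (\<Sum>k<Suc K. ?c k * lucas_U x (m - 2 * k))"
      using Suc.prems by simp
    finally show ?thesis by (simp only: lessThan_Suc_atMost)
  qed
  have "(\<Sum>k\<le>K. cdiff (int (Suc m)) (int k) * lucas_U x (Suc m + 1 - 2 * k))
      = (\<Sum>k\<le>K. ?c k * lucas_U x (m + 2 - 2 * k))
      + (\<Sum>k\<le>K. cdiff (int m) (int k - 1) * lucas_U x (m + 2 - 2 * k))"
    using cdiff_plus_1[of "int m"]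
    by (simp add: sum.distrib[symmetric] algebra_simps)
  also have "\<dots> = (\<Sum>k\<le>K. ?c k * (x * lucas_U x (m + 1 - 2 * k)))"
    by (simp only: shifted step sum.distrib)
  also have "\<dots> = x * (\<Sum>k\<le>K. ?c k * lucas_U x (m + 1 - 2 * k))"
    by (simp add: sum_distrib_left mult.left_commute)
  also have "\<dots> = x ^ Suc m"
    using Suc by simp
  finally show ?case .
qed

text \<open>
  The signed analogue of writing a Fibonacci number as a diagonal sum of Pascal's triangle.
  The summation runs over all \<open>k \<le> n\<close>, because the additional binomial coefficients vanish
  and the induction then has uniform limits.
\<close>
lemma lucas_U_eq_sum_binomial_full:
  "lucas_U x (Suc n) = (\<Sum>k\<le>n. (-1) ^ k * real ((n - k) choose k) * x ^ (n - 2 * k))"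
proof (induction n rule: induct_nat_012)
  case 0
  then show ?case by simp
next
  case 1
  then show ?case by simp
next
  case (ge2 n)
  let ?T = "\<lambda>n. \<Sum>k\<le>n. (-1) ^ k * real ((n - k) choose k) * x ^ (n - 2 * k)"
  let ?s = "\<lambda>j. (-1) ^ j * real ((n - j) choose Suc j) * x ^ (n - 2 * j)"
  have "x * ?T (Suc n) = x ^ (n + 2) - (\<Sum>j\<le>n. ?s j)"
  proof -
    (* The exponents agree only where the binomial coefficient is nonzero. *)
    have summand: "x * ((-1) ^ Suc j * real ((Suc n - Suc j) choose Suc j) * x ^ (Suc n - 2 * Suc j))
        = - ?s j" for j
    proof (cases "2 * j + 1 \<le> n")
      case True
      then have "n - 2 * j = Suc (Suc n - 2 * Suc j)" by simp
      then show ?thesis by simp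
    next
      case False
      then show ?thesis by (simp add: binomial_eq_0)
    qed
    have "?T (Suc n) = x ^ (n + 1)
        + (\<Sum>j\<le>n. (-1) ^ Suc j * real ((Suc n - Suc j) choose Suc j) * x ^ (Suc n - 2 * Suc j))"
      by (subst sum.atMost_Suc_shift) simp
    then show ?thesis
      by (simp only: distrib_left sum_distrib_left summand sum_negf) simp
  qed
  moreover have "?T (Suc (Suc n)) = x ^ (n + 2) - (\<Sum>j\<le>n. ?s j) - ?T n"
  proof -
    have "?T (Suc (Suc n)) = x ^ (n + 2)
        + (\<Sum>j\<le>Suc n. (-1) ^ Suc j * real ((Suc n - j) choose Suc j) * x ^ (n - 2 * j))"
      by (subst sum.atMost_Suc_shift) simp
    also have "(\<Sum>j\<le>Suc n. (-1) ^ Suc j * real ((Suc n - j) choose Suc j) * x ^ (n - 2 * j))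
        = (\<Sum>j\<le>n. (-1) ^ Suc j * real ((Suc n - j) choose Suc j) * x ^ (n - 2 * j))"
      by simp
    also have "\<dots> = (\<Sum>j\<le>n. - ?s j - (-1) ^ j * real ((n - j) choose j) * x ^ (n - 2 * j))"
      by (intro sum.cong refl) (simp add: Suc_diff_le algebra_simps)
    finally show ?thesis by (simp add: sum_subtractf sum_negf)
  qed
  ultimately show ?case
    using ge2 by simp
qed

lemma lucas_U_eq_sum_binomial:
  "lucas_U x (Suc n)
    = (\<Sum>k = 0..n div 2. (-1) ^ k * real ((n - k) choose k) * x ^ (n - 2 * k))"
  unfolding lucas_U_eq_sum_binomial_full
  by (rule sum.mono_neutral_right) (auto simp: binomial_eq_0)

section \<open>The periodic sequences\<close>

definition sign_wave :: "nat \<Rightarrow> nat \<Rightarrow> real" where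
  "sign_wave p j = (if j mod p < 2 then (-1) ^ (j div p) else 0)"

lemma sign_wave_add_period: "p > 0 \<Longrightarrow> sign_wave p (j + p) = - sign_wave p j"
  by (simp add: sign_wave_def)

lemma sign_wave_mod:
  assumes "p > 0"
  shows "sign_wave p (j mod (2 * p)) = sign_wave p j"
proof -
  have "sign_wave p (i + 2 * p * q) = sign_wave p i" for i q
  proof (induction q)
    case (Suc q)
    have "sign_wave p (i + 2 * p * Suc q) = sign_wave p (i + 2 * p * q + p + p)"
      by (simp add: algebra_simps)
    then show ?case
      using Suc assms by (simp only: sign_wave_add_period minus_minus)
  qed simp
  from this[of "j mod (2 * p)" "j div (2 * p)"] show ?thesis
    by simp
qed

lemma sign_wave_3_cases:
  "sign_wave 3 n = (if n mod 6 \<in> {0, 1} then 1 else if n mod 6 \<in> {3, 4} then -1 else 0)"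
proof -
  have "n mod 6 < 6" by simp
  then have "n mod 6 \<in> {0, 1, 2, 3, 4, 5}" by auto
  then have "sign_wave 3 (n mod 6)
      = (if n mod 6 \<in> {0, 1} then 1 else if n mod 6 \<in> {3, 4} then -1 else 0)"
    by (auto simp: sign_wave_def)
  then show ?thesis
    using sign_wave_mod[of 3 n] by simp
qed

lemma sign_wave_5_cases:
  "sign_wave 5 n = (if n mod 10 \<in> {0, 1} then 1 else if n mod 10 \<in> {5, 6} then -1 else 0)"
proof -
  have "n mod 10 < 10" by simp
  then have "n mod 10 \<in> {0, 1, 2, 3, 4, 5, 6, 7, 8, 9}"
    by (simp only: insert_iff empty_iff) presburger
  then have "sign_wave 5 (n mod 10)
      = (if n mod 10 \<in> {0, 1} then 1 else if n mod 10 \<in> {5, 6} then -1 else 0)"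
    by (auto simp: sign_wave_def)
  then show ?thesis
    using sign_wave_mod[of 5 n] by simp
qed

text \<open>
  The two floors differ by one if \<open>j mod p < 2\<close> and coincide otherwise; so the two signs
  either reinforce each other or cancel.
\<close>
lemma half_sign_difference_eq_sign_wave:
  assumes "p \<ge> 2"
  shows "1 / 2 * ((-1) powi (int j div int p) - (-1) powi ((int j - 2) div int p))
    = sign_wave p j"
proof -
  have j: "int j = int p * int (j div p) + int (j mod p)"
    by (metis mult_div_mod_eq of_nat_add of_nat_mult)
  have "j mod p < p" using assms by simp
  have *: "int j div int p = int (j div p)"
    by (simp add: zdiv_int)
  show ?thesis
  proof (cases "j mod p < 2")
    case True
    have "int j - 2 = int p * (int (j div p) - 1) + (int (j mod p) + int p - 2)"
      using j by (simp add: algebra_simps)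
    moreover have "0 \<le> int (j mod p) + int p - 2" "int (j mod p) + int p - 2 < int p"
      using True assms by simp_all
    ultimately have "(int j - 2) div int p = int (j div p) - 1"
      by (rule int_div_pos_eq)
    then show ?thesis
      using True by (simp add: * sign_wave_def power_int_diff)
  next
    case False
    have "int j - 2 = int p * int (j div p) + (int (j mod p) - 2)"
      using j by (simp add: algebra_simps)
    moreover have "0 \<le> int (j mod p) - 2" "int (j mod p) - 2 < int p"
      using False \<open>j mod p < p\<close> by linarith+
    ultimately have "(int j - 2) div int p = int (j div p)"
      by (rule int_div_pos_eq)
    then show ?thesis
      using False by (simp add: * sign_wave_def)
  qed
qed

text \<open>
  The nonzero weights sit at \<open>m - 2 i = p k\<close> and \<open>m - 2 i = p k + 1\<close>.  For each \<open>k\<close>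
  parity selects exactly one of the two, namely \<open>i = \<lfloor>(m - p k) / 2\<rfloor>\<close>.
\<close>
lemma sum_sign_wave_reindex:
  fixes a :: "int \<Rightarrow> real"
  assumes "p \<ge> 2"
  shows "(\<Sum>i = 0..m div 2. sign_wave p (m - 2 * i) * a (int i))
    = (\<Sum>k = 0..m div p. (-1) ^ k * a ((int m - int p * int k) div 2))"
proof -
  let ?I = "{i \<in> {0..m div 2}. (m - 2 * i) mod p < 2}"
  have inv: "(m - 2 * ((m - p * k) div 2)) div p = k"
      "(m - 2 * ((m - p * k) div 2)) mod p < 2" if "k \<in> {0..m div p}" for k
  proof -
    define d r where "d = m - p * k" and "r = d mod 2"
    have "p * k \<le> m"
      using that div_times_less_eq_dividend[of m p]
      by (metis atLeastAtMost_iff le_trans mult.commute mult_le_mono1)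
    then have "m = p * k + d"
      by (simp add: d_def)
    moreover have "d = 2 * (d div 2) + r"
      by (simp add: r_def)
    ultimately have eq: "m - 2 * ((m - p * k) div 2) = p * k + r"
      unfolding d_def[symmetric] by linarith
    have r: "r < 2" "r < p"
      using assms mod_less_divisor[of 2 d] by (simp_all only: r_def)
    show "(m - 2 * ((m - p * k) div 2)) div p = k"
      using r assms unfolding eq by (simp add: div_add1_eq)
    show "(m - 2 * ((m - p * k) div 2)) mod p < 2"
      using r unfolding eq by simp
  qed
  have inv': "(m - p * ((m - 2 * i) div p)) div 2 = i" if "i \<in> ?I" for i
  proof -
    have "m - 2 * i = p * ((m - 2 * i) div p) + (m - 2 * i) mod p"
      by simp
    moreover have "2 * i \<le> m" "(m - 2 * i) mod p < 2"
      using that by auto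
    ultimately have "m - p * ((m - 2 * i) div p) = 2 * i + (m - 2 * i) mod p"
      by linarith
    then show ?thesis
      using \<open>(m - 2 * i) mod p < 2\<close> by simp
  qed
  have nonneg: "int ((m - p * k) div 2) = (int m - int p * int k) div 2"
    if "k \<in> {0..m div p}" for k
  proof -
    have "p * k \<le> m"
      using that div_times_less_eq_dividend[of m p]
      by (metis atLeastAtMost_iff le_trans mult.commute mult_le_mono1)
    then show ?thesis
      by (simp add: zdiv_int of_nat_diff)
  qed
  have "(\<Sum>i = 0..m div 2. sign_wave p (m - 2 * i) * a (int i))
      = (\<Sum>i\<in>?I. (-1) ^ ((m - 2 * i) div p) * a (int i))"
    by (rule sum.mono_neutral_cong_right) (auto simp: sign_wave_def)
  also have "\<dots> = (\<Sum>k = 0..m div p. (-1) ^ k * a ((int m - int p * int k) div 2))"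
  proof (rule sum.reindex_bij_witness[where i = "\<lambda>k. (m - p * k) div 2"
        and j = "\<lambda>i. (m - 2 * i) div p"])
    fix i assume i: "i \<in> ?I"
    show "(m - p * ((m - 2 * i) div p)) div 2 = i"
      by (rule inv'[OF i])
    show k: "(m - 2 * i) div p \<in> {0..m div p}"
      by (simp add: div_le_mono)
    show "(-1) ^ ((m - 2 * i) div p) * a ((int m - int p * int ((m - 2 * i) div p)) div 2)
        = (-1) ^ ((m - 2 * i) div p) * a (int i)"
      by (simp only: nonneg[OF k, symmetric] inv'[OF i])
  next
    fix k assume k: "k \<in> {0..m div p}"
    show "(m - 2 * ((m - p * k) div 2)) div p = k"
      by (rule inv(1)[OF k])
    show "(m - p * k) div 2 \<in> ?I"
      using inv(2)[OF k] by (simp add: div_le_mono)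
  qed
  finally show ?thesis .
qed

lemma sum_half_sign_difference:
  assumes "p \<ge> 2"
  shows "(\<Sum>k = 0..m div 2. 1 / 2 * ((-1) powi ((int m - 2 * int k) div int p)
                              - (-1) powi ((int m - 2 * int k - 2) div int p)) * a (int k))
    = (\<Sum>k = 0..m div 2. sign_wave p (m - 2 * k) * a (int k))"
proof (intro sum.cong refl)
  fix k assume "k \<in> {0..m div 2}"
  then have "int m - 2 * int k = int (m - 2 * k)" by (simp add: of_nat_diff)
  then show "1 / 2 * ((-1) powi ((int m - 2 * int k) div int p)
      - (-1) powi ((int m - 2 * int k - 2) div int p)) * a (int k)
      = sign_wave p (m - 2 * k) * a (int k)"
    using half_sign_difference_eq_sign_wave[OF assms, of "m - 2 * k"] by metis
qed

section \<open>Evaluation at 1 and at the golden ratio\<close>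

lemma lucas_U_small:
  "lucas_U x 2 = x" "lucas_U x 3 = x * x - 1" "lucas_U x 4 = x * (x * x - 1) - x"
  "lucas_U x 5 = x * (x * (x * x - 1) - x) - (x * x - 1)"
  "lucas_U x 6 = x * (x * (x * (x * x - 1) - x) - (x * x - 1)) - (x * (x * x - 1) - x)"
  by (simp_all add: numeral_eq_Suc)

lemma lucas_U_1_eq_sign_wave: "lucas_U 1 (n + 1) = sign_wave 3 n"
proof (induction n rule: less_induct)
  case (less n)
  show ?case
  proof (cases "n < 3")
    case True
    then have "n \<in> {0, 1, 2}" by auto
    then show ?thesis by (auto simp: sign_wave_def lucas_U_small numeral_2_eq_2[symmetric])
  next
    case False
    then obtain i where n: "n = i + 3" by (metis add.commute le_Suc_ex not_less)
    have "lucas_U 1 (i + 3 + 1) = - lucas_U 1 (i + 1)"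
      by (simp add: numeral_eq_Suc)
    then show ?thesis
      using less[of i] n by (simp add: sign_wave_add_period)
  qed
qed

text \<open>
  Modulo \<open>x\<^sup>2 = x + 1\<close> every \<open>U\<^sub>n\<close> is a linear polynomial in \<open>x\<close>; dividing the difference of the
  values at the two roots by \<open>x - y\<close> extracts the coefficient of \<open>x\<close>.
\<close>
lemma lucas_U_golden_diff_eq_sign_wave:
  assumes "x * x = x + 1" and "y * y = y + 1"
  shows "lucas_U x (n + 2) - lucas_U y (n + 2) = sign_wave 5 n * (x - y)"
proof (induction n rule: less_induct)
  case (less n)
  have neg: "lucas_U z (i + 5) = - lucas_U z i" if z: "z * z = z + 1" for z i
  proof -
    have z2: "z * (z * t) = z * t + t" for t
      using z by (metis distrib_right mult.assoc mult_1)
    let ?a = "lucas_U z i" and ?b = "lucas_U z (Suc i)"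
    have u3: "lucas_U z (Suc (Suc (Suc i))) = z * ?b - z * ?a"
      by (simp add: right_diff_distrib z2)
    have u4: "lucas_U z (Suc (Suc (Suc (Suc i)))) = ?b - z * ?a"
      by (subst lucas_U.simps(3)) (simp only: u3 lucas_U.simps(3), simp add: right_diff_distrib z2)
    have "lucas_U z (Suc (Suc (Suc (Suc (Suc i))))) = - ?a"
      by (subst lucas_U.simps(3)) (simp only: u3 u4, simp add: right_diff_distrib z2)
    then show ?thesis
      by (simp add: numeral_eq_Suc)
  qed
  show ?case
  proof (cases "n < 5")
    case True
    then have "n \<in> {0, 1, 2, 3, 4}" by auto
    then show ?thesis
      using assms by (auto simp: sign_wave_def lucas_U_small algebra_simps numeral_2_eq_2[symmetric])
  next
    case False
    then obtain i where n: "n = i + 5" by (metis add.commute le_Suc_ex not_less)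
    have "lucas_U x (n + 2) - lucas_U y (n + 2) = - (lucas_U x (i + 2) - lucas_U y (i + 2))"
      using neg[OF assms(1), of "i + 2"] neg[OF assms(2), of "i + 2"] n
      by (simp add: add.assoc add.left_commute add.commute)
    then show ?thesis
      using less[of i] n by (simp add: sign_wave_add_period)
  qed
qed

lemma golden_power_diff_eq_fib:
  fixes x y :: real
  assumes "x * x = x + 1" and "y * y = y + 1"
  shows "x ^ n - y ^ n = real (fib n) * (x - y)"
proof (induction n rule: fib.induct)
  case (3 n)
  have "z ^ Suc (Suc n) = z ^ Suc n + z ^ n" if "z * z = z + 1" for z :: real
    using that by (metis distrib_right mult.assoc mult_1 power_Suc)
  then show ?case
    using 3 assms by (simp add: algebra_simps del: power_Suc)
qed simp_all

lemma golden_roots: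
  obtains x y :: real where "x * x = x + 1" "y * y = y + 1" "x \<noteq> y"
proof
  show "(1 + sqrt 5) / 2 * ((1 + sqrt 5) / 2) = (1 + sqrt 5) / 2 + 1"
    "(1 - sqrt 5) / 2 * ((1 - sqrt 5) / 2) = (1 - sqrt 5) / 2 + 1"
    by (simp_all add: field_simps)
qed simp

lemma sum_sign_wave_3_cdiff:
  "(\<Sum>k = 0..m div 2. sign_wave 3 (m - 2 * k) * cdiff (int m) (int k)) = 1"
proof -
  have "(\<Sum>k = 0..m div 2. sign_wave 3 (m - 2 * k) * cdiff (int m) (int k))
      = (\<Sum>k\<le>m div 2. cdiff (int m) (int k) * lucas_U 1 (m + 1 - 2 * k))"
  proof (rule sum.cong)
    fix k assume "k \<in> {..m div 2}"
    then have "m + 1 - 2 * k = m - 2 * k + 1" by auto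
    then show "sign_wave 3 (m - 2 * k) * cdiff (int m) (int k)
        = cdiff (int m) (int k) * lucas_U 1 (m + 1 - 2 * k)"
      by (simp only: lucas_U_1_eq_sign_wave mult.commute)
  qed (simp add: atMost_atLeast0)
  also have "\<dots> = 1"
    by (subst power_eq_sum_cdiff_lucas_U) simp_all
  finally show ?thesis .
qed

text \<open>
  Both expansions of degree \<open>m + 1\<close> have an additional last term if \<open>m\<close> is odd, but it does not
  depend on the root, so it cancels in the difference.
\<close>
lemma sum_sign_wave_5_cdiff:
  "(\<Sum>k = 0..m div 2. sign_wave 5 (m - 2 * k) * cdiff (int m + 1) (int k)) = real (fib (m + 1))"
proof -
  obtain x y :: real where xy: "x * x = x + 1" "y * y = y + 1" "x \<noteq> y"
    by (rule golden_roots)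
  let ?K = "(m + 1) div 2"
  let ?c = "\<lambda>k. cdiff (int (m + 1)) (int k)"
  have "real (fib (m + 1)) * (x - y) = x ^ (m + 1) - y ^ (m + 1)"
    by (rule golden_power_diff_eq_fib[OF xy(1,2), symmetric])
  also have "\<dots> = (\<Sum>k\<le>?K. ?c k * lucas_U x (m + 1 + 1 - 2 * k))
      - (\<Sum>k\<le>?K. ?c k * lucas_U y (m + 1 + 1 - 2 * k))"
    by (subst (1 2) power_eq_sum_cdiff_lucas_U) simp_all
  also have "\<dots> = (\<Sum>k\<le>?K. ?c k * (lucas_U x (m + 2 - 2 * k) - lucas_U y (m + 2 - 2 * k)))"
    by (simp add: sum_subtractf right_diff_distrib)
  also have "\<dots> = (\<Sum>k = 0..m div 2. sign_wave 5 (m - 2 * k) * ?c k * (x - y))"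
  proof (rule sum.mono_neutral_cong_right)
    show "\<forall>k\<in>{..?K} - {0..m div 2}.
        ?c k * (lucas_U x (m + 2 - 2 * k) - lucas_U y (m + 2 - 2 * k)) = 0"
    proof
      fix k assume "k \<in> {..?K} - {0..m div 2}"
      then have "m + 2 - 2 * k = Suc 0" by auto
      then show "?c k * (lucas_U x (m + 2 - 2 * k) - lucas_U y (m + 2 - 2 * k)) = 0"
        by simp
    qed
  next
    fix k assume "k \<in> {0..m div 2}"
    then have "m + 2 - 2 * k = m - 2 * k + 2" by auto
    then show "?c k * (lucas_U x (m + 2 - 2 * k) - lucas_U y (m + 2 - 2 * k))
        = sign_wave 5 (m - 2 * k) * ?c k * (x - y)"
      by (simp only: lucas_U_golden_diff_eq_sign_wave[OF xy(1,2)] mult_ac)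
  qed auto
  also have "\<dots> = (\<Sum>k = 0..m div 2. sign_wave 5 (m - 2 * k) * ?c k) * (x - y)"
    by (simp add: sum_distrib_right)
  finally show ?thesis
    using xy(3) by (simp add: add.commute)
qed

lemma sum_alternating_binomial:
  "(\<Sum>k = 0..n div 2. (-1) ^ k * ibinom (int n - int k) (int k)) = sign_wave 3 n"
proof -
  have "(\<Sum>k = 0..n div 2. (-1) ^ k * ibinom (int n - int k) (int k))
      = (\<Sum>k = 0..n div 2. (-1) ^ k * real ((n - k) choose k) * 1 ^ (n - 2 * k))"
  proof (intro sum.cong refl)
    fix k assume "k \<in> {0..n div 2}"
    then have "int n - int k = int (n - k)" by (auto simp: of_nat_diff)
    then show "(-1) ^ k * ibinom (int n - int k) (int k)
        = (-1) ^ k * real ((n - k) choose k) * 1 ^ (n - 2 * k)"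
      by (simp only: ibinom_of_nat) simp
  qed
  also have "\<dots> = sign_wave 3 n"
    unfolding lucas_U_eq_sum_binomial[symmetric]
    using lucas_U_1_eq_sign_wave[of n] by simp
  finally show ?thesis .
qed

lemma sum_alternating_binomial_fib:
  "(\<Sum>k = 0..n div 2. (-1) ^ k * ibinom (int n - int k + 1) (int k) * real (fib (n - 2 * k + 1)))
    = sign_wave 5 n"
proof -
  obtain x y :: real where xy: "x * x = x + 1" "y * y = y + 1" "x \<noteq> y"
    by (rule golden_roots)
  let ?K = "(n + 1) div 2"
  let ?b = "\<lambda>k. (-1) ^ k * real ((n + 1 - k) choose k)"
  have "sign_wave 5 n * (x - y) = lucas_U x (Suc (n + 1)) - lucas_U y (Suc (n + 1))"
    using lucas_U_golden_diff_eq_sign_wave[OF xy(1,2), of n] by simp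
  also have "\<dots> = (\<Sum>k = 0..?K. ?b k * (x ^ (n + 1 - 2 * k) - y ^ (n + 1 - 2 * k)))"
    by (simp only: lucas_U_eq_sum_binomial sum_subtractf right_diff_distrib)
  also have "\<dots> = (\<Sum>k = 0..?K. ?b k * real (fib (n + 1 - 2 * k))) * (x - y)"
    by (simp only: golden_power_diff_eq_fib[OF xy(1,2)] sum_distrib_right mult.assoc)
  also have "(\<Sum>k = 0..?K. ?b k * real (fib (n + 1 - 2 * k)))
      = (\<Sum>k = 0..n div 2. (-1) ^ k * ibinom (int n - int k + 1) (int k)
          * real (fib (n - 2 * k + 1)))"
  proof (rule sum.mono_neutral_cong_right)
    (* If n is odd, the term k = (n + 1) / 2 carries the factor fib 0. *)
    show "\<forall>k\<in>{0..?K} - {0..n div 2}. ?b k * real (fib (n + 1 - 2 * k)) = 0"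
    proof
      fix k assume "k \<in> {0..?K} - {0..n div 2}"
      then have "n + 1 - 2 * k = 0" by auto
      then show "?b k * real (fib (n + 1 - 2 * k)) = 0"
        by simp
    qed
  next
    fix k assume k: "k \<in> {0..n div 2}"
    then have "int n - int k + 1 = int (n + 1 - k)" by (auto simp: of_nat_diff)
    moreover have "n + 1 - 2 * k = n - 2 * k + 1" using k by auto
    ultimately show "?b k * real (fib (n + 1 - 2 * k))
        = (-1) ^ k * ibinom (int n - int k + 1) (int k) * real (fib (n - 2 * k + 1))"
      by (simp only: ibinom_of_nat)
  qed auto
  finally show ?thesis
    using xy(3) by simp
qed

theorem corollary18:
  shows
   "(\<forall>m n :: nat. n > 0 \<longrightarrow>
       (\<Sum>k = 0..m div 2. 1 / 2 * ((-1) powi ((int m - 2 * int k) div 3)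
                              - (-1) powi ((int m - 2 * int k - 2) div 3))
                            * cdiff (int m) (int k))
         = (\<Sum>k = 0..(n - 1) div 3. (-1) ^ k
              * cdiff (int n - 1) ((int n - 1 - 3 * int k) div 2))
     \<and> (\<Sum>k = 0..(n - 1) div 3. (-1) ^ k
              * cdiff (int n - 1) ((int n - 1 - 3 * int k) div 2)) = 1)
  \<and> (\<forall>m n :: nat. n = m + 1 \<longrightarrow>
       (\<Sum>k = 0..m div 2. 1 / 2 * ((-1) powi ((int m - 2 * int k) div 5)
                              - (-1) powi ((int m - 2 * int k - 2) div 5))
                            * cdiff (int m + 1) (int k))
         = (\<Sum>k = 0..(n - 1) div 5. (-1) ^ k
              * cdiff (int n) ((int n - 1 - 5 * int k) div 2))
     \<and> (\<Sum>k = 0..(n - 1) div 5. (-1) ^ k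
              * cdiff (int n) ((int n - 1 - 5 * int k) div 2))
         = real (fib (m + 1)))
  \<and> (\<forall>n :: nat.
       (\<Sum>k = 0..n div 2. (-1) ^ k * ibinom (int n - int k) (int k))
         = (if n mod 6 \<in> {0, 1} then 1 else if n mod 6 \<in> {3, 4} then -1 else 0))
  \<and> (\<forall>n :: nat.
       (\<Sum>k = 0..n div 2. (-1) ^ k * ibinom (int n - int k + 1) (int k)
                            * real (fib (n - 2 * k + 1)))
         = (if n mod 10 \<in> {0, 1} then 1 else if n mod 10 \<in> {5, 6} then -1 else 0))"
proof (intro conjI allI impI)
  have three: "(\<Sum>k = 0..(n - 1) div 3. (-1) ^ k
              * cdiff (int n - 1) ((int n - 1 - 3 * int k) div 2)) = 1" if "n > 0" for n
    using that sum_sign_wave_reindex[of 3 "n - 1" "cdiff (int n - 1)"]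
      sum_sign_wave_3_cdiff[of "n - 1"] by (simp add: of_nat_diff)
  fix m n :: nat
  assume "n > 0"
  then show "(\<Sum>k = 0..(n - 1) div 3. (-1) ^ k
              * cdiff (int n - 1) ((int n - 1 - 3 * int k) div 2)) = 1"
    by (rule three)
  show "(\<Sum>k = 0..m div 2. 1 / 2 * ((-1) powi ((int m - 2 * int k) div 3)
                              - (-1) powi ((int m - 2 * int k - 2) div 3))
                            * cdiff (int m) (int k))
         = (\<Sum>k = 0..(n - 1) div 3. (-1) ^ k
              * cdiff (int n - 1) ((int n - 1 - 3 * int k) div 2))"
    using sum_half_sign_difference[of 3 m "cdiff (int m)"] sum_sign_wave_3_cdiff[of m]
      three[OF \<open>n > 0\<close>] by simp
next
  fix m n :: nat
  assume n: "n = m + 1"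
  have five: "(\<Sum>k = 0..m div 2. sign_wave 5 (m - 2 * k) * cdiff (int m + 1) (int k))
      = (\<Sum>k = 0..(n - 1) div 5. (-1) ^ k * cdiff (int n) ((int n - 1 - 5 * int k) div 2))"
    using sum_sign_wave_reindex[of 5 m "cdiff (int m + 1)"] n by (simp add: add.commute)
  then show "(\<Sum>k = 0..(n - 1) div 5. (-1) ^ k
              * cdiff (int n) ((int n - 1 - 5 * int k) div 2)) = real (fib (m + 1))"
    using sum_sign_wave_5_cdiff[of m] by simp
  show "(\<Sum>k = 0..m div 2. 1 / 2 * ((-1) powi ((int m - 2 * int k) div 5)
                              - (-1) powi ((int m - 2 * int k - 2) div 5))
                            * cdiff (int m + 1) (int k))
         = (\<Sum>k = 0..(n - 1) div 5. (-1) ^ k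
              * cdiff (int n) ((int n - 1 - 5 * int k) div 2))"
    using sum_half_sign_difference[of 5 m "cdiff (int m + 1)"] five by simp
next
  fix n :: nat
  show "(\<Sum>k = 0..n div 2. (-1) ^ k * ibinom (int n - int k) (int k))
         = (if n mod 6 \<in> {0, 1} then 1 else if n mod 6 \<in> {3, 4} then -1 else 0)"
    by (simp only: sum_alternating_binomial sign_wave_3_cases)
next
  fix n :: nat
  show "(\<Sum>k = 0..n div 2. (-1) ^ k * ibinom (int n - int k + 1) (int k)
                            * real (fib (n - 2 * k + 1)))
         = (if n mod 10 \<in> {0, 1} then 1 else if n mod 10 \<in> {5, 6} then -1 else 0)"
    by (simp only: sum_alternating_binomial_fib sign_wave_5_cases)
qed

end
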